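(* There exists a complete Heyting algebra $A$ whose Scott space $(A,\sigma(A))$ is non-sober.
   Context: For a poset $P$, a subset $U\subseteq P$ is Scott open if (i) $U$ is an upper set, i.e. $U={\uparrow}U=\{x\in P: y\le x\text{ for some }y\in U\}$, and (ii) for every (nonempty) directed subset $D\subseteq P$ whose supremum $\bigvee D$ exists, $\bigvee D\in U$ implies $D\cap U\neq\emptyset$. The Scott open sets form the Scott topology $\sigma(P)$, and $(P,\sigma(P))$ is the Scott space of $P$. A complete Heyting algebra (also called a frame) is a complete lattice $A$ satisfying $a\wedge\bigvee\{a_i:i\in I\}=\bigvee\{a\wedge a_i:i\in I\}$ for all $a\in A$ and all families $\{a_i:i\in I\}\subseteq A$. A nonempty subset $A$ of a space $X$ is irreducible if for any closed subsets $F_1,F_2$ of $X$, $A\subseteq F_1\cup F_2$ implies $A\subseteq F_1$ or $A\subseteq F_2$. A space $X$ is sober if every irreducible closed subset of $X$ is the closure of a unique singleton. *)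

theory Defs
  imports "HOL-Algebra.Complete_Lattice" "HOL-Analysis.Abstract_Topology"
begin

locale complete_heyting_algebra = complete_lattice +
  assumes meet_sup_distrib:
    "\<lbrakk>a \<in> carrier L; B \<subseteq> carrier L\<rbrakk> \<Longrightarrow> a \<sqinter> (\<Squnion>B) = \<Squnion>((\<lambda>b. a \<sqinter> b) ` B)"

definition directed_subset :: "('a, 'b) gorder_scheme \<Rightarrow> 'a set \<Rightarrow> bool" where
  "directed_subset L D \<longleftrightarrow>
     D \<subseteq> carrier L \<and> D \<noteq> {} \<and>
     (\<forall>x\<in>D. \<forall>y\<in>D. \<exists>z\<in>D. x \<sqsubseteq>\<^bsub>L\<^esub> z \<and> y \<sqsubseteq>\<^bsub>L\<^esub> z)"

definition up_closure :: "('a, 'b) gorder_scheme \<Rightarrow> 'a set \<Rightarrow> 'a set" where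
  "up_closure L U = {x \<in> carrier L. \<exists>y\<in>U. y \<sqsubseteq>\<^bsub>L\<^esub> x}"

definition scott_open :: "('a, 'b) gorder_scheme \<Rightarrow> 'a set \<Rightarrow> bool" where
  "scott_open L U \<longleftrightarrow>
     U \<subseteq> carrier L \<and> U = up_closure L U \<and>
     (\<forall>D s. directed_subset L D \<longrightarrow> is_lub L s D \<longrightarrow> s \<in> U \<longrightarrow> D \<inter> U \<noteq> {})"

text \<open>\<^term>\<open>topology\<close> is only meaningful on families satisfying \<^term>\<open>istopology\<close>;
  the lemmas below establish this for every partial order.\<close>

definition scott_topology :: "('a, 'b) gorder_scheme \<Rightarrow> 'a topology" where
  "scott_topology L = topology (scott_open L)"

lemma (in weak_partial_order) scott_open_iff:
  "scott_open L U \<longleftrightarrow>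
     U \<subseteq> carrier L \<and> (\<forall>x\<in>U. \<forall>y\<in>carrier L. x \<sqsubseteq> y \<longrightarrow> y \<in> U) \<and>
     (\<forall>D s. directed_subset L D \<longrightarrow> is_lub L s D \<longrightarrow> s \<in> U \<longrightarrow> D \<inter> U \<noteq> {})"
proof -
  have "U = up_closure L U \<longleftrightarrow> (\<forall>x\<in>U. \<forall>y\<in>carrier L. x \<sqsubseteq> y \<longrightarrow> y \<in> U)"
    if "U \<subseteq> carrier L"
  proof
    assume eq: "U = up_closure L U"
    show "\<forall>x\<in>U. \<forall>y\<in>carrier L. x \<sqsubseteq> y \<longrightarrow> y \<in> U"
      by (subst (2) eq) (auto simp: up_closure_def)
  next
    assume "\<forall>x\<in>U. \<forall>y\<in>carrier L. x \<sqsubseteq> y \<longrightarrow> y \<in> U"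
    with that show "U = up_closure L U"
      unfolding up_closure_def using le_refl by blast
  qed
  then show ?thesis
    unfolding scott_open_def by blast
qed

lemma (in weak_partial_order) istopology_scott_open: "istopology (scott_open L)"
  unfolding istopology_def
proof (intro conjI allI impI)
  fix U V assume U: "scott_open L U" and V: "scott_open L V"
  have "D \<inter> (U \<inter> V) \<noteq> {}" if D: "directed_subset L D" "is_lub L s D" and s: "s \<in> U \<inter> V" for D s
  proof -
    obtain x y where "x \<in> D" "x \<in> U" "y \<in> D" "y \<in> V"
      using U V D s unfolding scott_open_iff by blast
    moreover from this obtain z where "z \<in> D" "z \<in> carrier L" "x \<sqsubseteq> z" "y \<sqsubseteq> z"
      using D(1) unfolding directed_subset_def by blast
    ultimately show ?thesis
      using U V unfolding scott_open_iff by blast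
  qed
  with U V show "scott_open L (U \<inter> V)"
    unfolding scott_open_iff by blast
next
  fix K assume K: "\<forall>U\<in>K. scott_open L U"
  have "D \<inter> \<Union>K \<noteq> {}" if D: "directed_subset L D" "is_lub L s D" and s: "s \<in> \<Union>K" for D s
  proof -
    obtain U where "U \<in> K" "s \<in> U" using s by blast
    with K D have "D \<inter> U \<noteq> {}" by (auto simp: scott_open_def)
    with \<open>U \<in> K\<close> show ?thesis by blast
  qed
  moreover have "\<Union>K \<subseteq> carrier L"
    using K by (auto simp: scott_open_def)
  moreover have "y \<in> \<Union>K" if "x \<in> \<Union>K" "y \<in> carrier L" "x \<sqsubseteq> y" for x y
    using K that unfolding scott_open_iff by (meson Union_iff)
  ultimately show "scott_open L (\<Union>K)"
    unfolding scott_open_iff by simp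
qed

lemma (in weak_partial_order) openin_scott_topology [simp]:
  "openin (scott_topology L) U \<longleftrightarrow> scott_open L U"
  by (simp add: scott_topology_def istopology_scott_open)

lemma (in weak_partial_order) topspace_scott_topology [simp]:
  "topspace (scott_topology L) = carrier L"
proof -
  have "scott_open L (carrier L)"
    unfolding scott_open_iff directed_subset_def by blast
  moreover have "U \<subseteq> carrier L" if "scott_open L U" for U
    using that unfolding scott_open_def by blast
  ultimately show ?thesis
    unfolding topspace_def openin_scott_topology by blast
qed

definition irreducible_in :: "'a topology \<Rightarrow> 'a set \<Rightarrow> bool" where
  "irreducible_in X A \<longleftrightarrow>
     A \<subseteq> topspace X \<and> A \<noteq> {} \<and>
     (\<forall>F1 F2. closedin X F1 \<longrightarrow> closedin X F2 \<longrightarrow> A \<subseteq> F1 \<union> F2 \<longrightarrow> A \<subseteq> F1 \<or> A \<subseteq> F2)"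

definition sober_space :: "'a topology \<Rightarrow> bool" where
  "sober_space X \<longleftrightarrow>
     (\<forall>A. irreducible_in X A \<longrightarrow> closedin X A \<longrightarrow>
        (\<exists>!x. x \<in> topspace X \<and> A = Abstract_Topology.closure_of X {x}))"

text \<open>HOL has no quantification over types, so the existence of an algebra is stated for carriers
  inside one fixed type, chosen large enough to hold every algebra of cardinality at most that of
  the triple power set of the naturals. The carrier is an arbitrary subset of this type and its
  order is arbitrary (unrelated to inclusion).\<close>

type_synonym carrier_universe = "nat set set set"

end

theory Submission
  imports Defs "HOL-Library.Nat_Bijection"
begin

text \<open>The compact upper sets of a complete lattice \<open>L\<close> with its Scott topology, ordered by reverse
  inclusion, form a frame: arbitrary intersections of compact upper sets are compact, because \<open>L\<close>
  is well-filtered and coherent, so suprema are intersections and binary meets are unions. If \<open>E\<close> is an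
  irreducible closed set of \<open>L\<close> without greatest element, the compact upper sets meeting \<open>E\<close> form an
  irreducible closed set of the frame that is not the closure of a point. A complete lattice with
  such an \<open>E\<close> is obtained from a freely generated set of points, each turned into a coatom that is the
  supremum of an ascending chain: every two open sets that contain more than the top share a
  coatom, so \<open>E = - {Top}\<close> is irreducible.\<close>

section \<open>The Scott topology of a complete lattice\<close>

definition filtered :: "'a set set \<Rightarrow> bool" where
  "filtered \<G> \<longleftrightarrow> \<G> \<noteq> {} \<and> (\<forall>K\<in>\<G>. \<forall>K'\<in>\<G>. \<exists>K''\<in>\<G>. K'' \<subseteq> K \<inter> K')"

definition updirected :: "'a::order set \<Rightarrow> bool" where
  "updirected D \<longleftrightarrow> D \<noteq> {} \<and> (\<forall>x\<in>D. \<forall>y\<in>D. \<exists>z\<in>D. x \<le> z \<and> y \<le> z)"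

lemma updirectedE:
  assumes "updirected D" "x \<in> D" "y \<in> D"
  obtains z where "z \<in> D" "x \<le> z" "y \<le> z"
  using assms by (auto simp: updirected_def)

definition scott_closed :: "'a::complete_lattice set \<Rightarrow> bool" where
  "scott_closed F \<longleftrightarrow>
     (\<forall>x\<in>F. \<forall>y. y \<le> x \<longrightarrow> y \<in> F) \<and> (\<forall>D. updirected D \<longrightarrow> D \<subseteq> F \<longrightarrow> Sup D \<in> F)"

text \<open>The second conjunct is compactness, dualised from directed open covers to filtered families of
  closed sets.\<close>

definition compact_upper :: "'a::complete_lattice set \<Rightarrow> bool" where
  "compact_upper K \<longleftrightarrow>
     (\<forall>x\<in>K. \<forall>y. x \<le> y \<longrightarrow> y \<in> K) \<and>
     (\<forall>\<C>. filtered \<C> \<longrightarrow> (\<forall>C\<in>\<C>. scott_closed C \<and> C \<inter> K \<noteq> {}) \<longrightarrow> \<Inter>\<C> \<inter> K \<noteq> {})"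

lemma scott_closed_down: "scott_closed F \<Longrightarrow> x \<in> F \<Longrightarrow> y \<le> x \<Longrightarrow> y \<in> F"
  by (auto simp: scott_closed_def)

lemma scott_closed_Sup: "scott_closed F \<Longrightarrow> updirected D \<Longrightarrow> D \<subseteq> F \<Longrightarrow> Sup D \<in> F"
  by (auto simp: scott_closed_def)

lemma compact_upper_up: "compact_upper K \<Longrightarrow> x \<in> K \<Longrightarrow> x \<le> y \<Longrightarrow> y \<in> K"
  by (auto simp: compact_upper_def)

lemma compact_upper_filtered:
  assumes "compact_upper K" "filtered \<C>" "\<And>C. C \<in> \<C> \<Longrightarrow> scott_closed C \<and> C \<inter> K \<noteq> {}"
  shows "\<Inter>\<C> \<inter> K \<noteq> {}"
  using assms unfolding compact_upper_def by blast

lemma scott_closed_Inter: "(\<And>C. C \<in> \<C> \<Longrightarrow> scott_closed C) \<Longrightarrow> scott_closed (\<Inter>\<C>)"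
  unfolding scott_closed_def by (simp add: le_Inf_iff) blast

lemma updirected_sup_image: "updirected D \<Longrightarrow> updirected ((\<lambda>d. sup d (k::'a::lattice)) ` D)"
  unfolding updirected_def by simp (blast intro: le_supI1)

text \<open>For \<open>D = {}\<close> the left side is \<open>k\<close> and the right side is
  \<open>bot\<close>, whence the restriction.\<close>

lemma sup_Sup_nonempty:
  assumes "D \<noteq> {}"
  shows "sup (Sup D) (k::'a::complete_lattice) = Sup ((\<lambda>d. sup d k) ` D)"
proof (rule antisym)
  obtain e where "e \<in> D" using assms by blast
  then have "k \<le> Sup ((\<lambda>d. sup d k) ` D)" by (rule SUP_upper2) simp
  moreover have "d \<le> Sup ((\<lambda>d. sup d k) ` D)" if "d \<in> D" for d
    using that by (rule SUP_upper2) simp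
  ultimately show "sup (Sup D) k \<le> Sup ((\<lambda>d. sup d k) ` D)"
    by (intro sup_least Sup_least)
  show "Sup ((\<lambda>d. sup d k) ` D) \<le> sup (Sup D) k"
    by (rule SUP_least) (intro sup_mono Sup_upper order_refl)
qed

text \<open>Joining with a fixed \<open>k\<close> preserves directed suprema, so it is Scott
  continuous.\<close>

lemma scott_closed_sup_preimage:
  assumes "scott_closed A"
  shows "scott_closed {x. sup x k \<in> A}"
  unfolding scott_closed_def
proof safe
  fix x y assume "sup x k \<in> A" "y \<le> x"
  then show "sup y k \<in> A"
    by (rule scott_closed_down[OF assms _ sup_mono[OF _ order_refl]])
next
  fix D assume "updirected D" "D \<subseteq> {x. sup x k \<in> A}"
  moreover from this have "sup (Sup D) k = Sup ((\<lambda>d. sup d k) ` D)"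
    by (intro sup_Sup_nonempty) (simp add: updirected_def)
  ultimately show "sup (Sup D) k \<in> A"
    using scott_closed_Sup[OF assms updirected_sup_image[of D k]] by auto
qed

text \<open>Joins are only separately Scott continuous, so compactness of \<open>K\<close> has to make up for the
  missing joint continuity.\<close>

lemma scott_closed_sup_compact:
  assumes A: "scott_closed A" and K: "compact_upper K"
  shows "scott_closed {x. \<exists>k\<in>K. sup x k \<in> A}"
  unfolding scott_closed_def
proof (intro conjI ballI allI impI)
  fix x y assume "x \<in> {x. \<exists>k\<in>K. sup x k \<in> A}" "y \<le> x"
  moreover from this(2) have "sup y k \<le> sup x k" for k
    by (intro sup_mono order_refl)
  ultimately show "y \<in> {x. \<exists>k\<in>K. sup x k \<in> A}"
    using scott_closed_down[OF A] by blast
next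
  fix D assume D: "updirected D" "D \<subseteq> {x. \<exists>k\<in>K. sup x k \<in> A}"
  \<comment> \<open>Different \<open>d\<close> may have different witnesses \<open>k\<close>, but
    the closed sets of witnesses shrink as \<open>d\<close> grows, and compactness of
    \<open>K\<close> provides a common one.\<close>
  let ?\<C> = "(\<lambda>d. {k. sup d k \<in> A}) ` D"
  have mono: "{k. sup e k \<in> A} \<subseteq> {k. sup d k \<in> A}" if "d \<le> e" for d e
    using scott_closed_down[OF A _ sup_mono[OF that order_refl]] by blast
  have "filtered ?\<C>"
    unfolding filtered_def
  proof (intro conjI ballI)
    show "?\<C> \<noteq> {}" using D(1) by (simp add: updirected_def)
    fix X Y assume "X \<in> ?\<C>" "Y \<in> ?\<C>"
    then obtain d e where de: "d \<in> D" "e \<in> D"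
      and XY: "X = {k. sup d k \<in> A}" "Y = {k. sup e k \<in> A}" by blast
    from de D(1) obtain z where "z \<in> D" "d \<le> z" "e \<le> z" unfolding updirected_def by blast
    then show "\<exists>Z\<in>?\<C>. Z \<subseteq> X \<inter> Y"
      using mono unfolding XY by blast
  qed
  moreover have "scott_closed C \<and> C \<inter> K \<noteq> {}" if C: "C \<in> ?\<C>" for C
  proof -
    obtain d where "d \<in> D" and C': "C = {k. sup d k \<in> A}" using C by blast
    then have "C \<inter> K \<noteq> {}" using D(2) by blast
    moreover have "scott_closed C"
      using scott_closed_sup_preimage[OF A, of d] by (simp add: C' sup.commute)
    ultimately show ?thesis by blast
  qed
  ultimately have "\<Inter>?\<C> \<inter> K \<noteq> {}" by (rule compact_upper_filtered[OF K])
  then obtain k where k: "k \<in> K" "\<And>d. d \<in> D \<Longrightarrow> sup d k \<in> A" by blast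
  then have "Sup D \<in> {x. sup x k \<in> A}"
    by (intro scott_closed_Sup[OF scott_closed_sup_preimage[OF A] D(1)]) blast
  with k(1) show "Sup D \<in> {x. \<exists>k\<in>K. sup x k \<in> A}" by blast
qed

lemma chain_filtered:
  assumes "\<C> \<noteq> {}" "\<And>X Y. X \<in> \<C> \<Longrightarrow> Y \<in> \<C> \<Longrightarrow> X \<subseteq> Y \<or> Y \<subseteq> X"
  shows "filtered \<C>"
  using assms unfolding filtered_def by (metis Int_absorb1 Int_absorb2 order_refl)

text \<open>Zorn's lemma applies: a nonempty chain in \<open>M\<close> is directed, so its supremum
  is a bound in \<open>M\<close>.\<close>

lemma scott_closed_maximal:
  assumes "scott_closed M" "M \<noteq> {}"
  shows "\<exists>a\<in>M. \<forall>x\<in>M. a \<le> x \<longrightarrow> x = a"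
proof (rule predicate_Zorn)
  show "partial_order_on M (relation_of (\<le>) M)"
    by (rule partial_order_on_relation_ofI) auto
  fix C assume C: "C \<in> Chains (relation_of (\<le>) M)"
  then have sub: "C \<subseteq> M" and tot: "\<And>x y. x \<in> C \<Longrightarrow> y \<in> C \<Longrightarrow> x \<le> y \<or> y \<le> x"
    unfolding Chains_def relation_of_def by blast+
  show "\<exists>u\<in>M. \<forall>a\<in>C. a \<le> u"
  proof (cases "C = {}")
    case True
    then show ?thesis using assms(2) by blast
  next
    case False
    then have "updirected C" using tot unfolding updirected_def by blast
    then have "Sup C \<in> M" using sub scott_closed_Sup[OF assms(1)] by blast
    then show ?thesis using Sup_upper by blast
  qed
qed

text \<open>Well-filteredness. In a minimal closed set \<open>M\<close> meeting all members of \<open>\<G>\<close>, every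
  element lies below an element of \<open>M \<inter> K\<close>, for each \<open>K\<close>; hence the maximal elements of \<open>M\<close>
  lie in all \<open>K\<close>.\<close>

lemma well_filtered:
  assumes A: "scott_closed A" and \<G>: "filtered \<G>"
    and meet: "\<And>K. K \<in> \<G> \<Longrightarrow> compact_upper K \<and> A \<inter> K \<noteq> {}"
  shows "A \<inter> \<Inter>\<G> \<noteq> {}"
proof -
  define Z where "Z = {C. scott_closed C \<and> C \<subseteq> A \<and> (\<forall>K\<in>\<G>. C \<inter> K \<noteq> {})}"
  have "\<exists>M\<in>Z. \<forall>C\<in>Z. M \<supseteq> C \<longrightarrow> C = M"
  proof (rule predicate_Zorn)
    show "partial_order_on Z (relation_of (\<supseteq>) Z)"
      by (rule partial_order_on_relation_ofI) auto
    fix \<C> assume "\<C> \<in> Chains (relation_of (\<supseteq>) Z)"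
    then have sub: "\<C> \<subseteq> Z" and tot: "\<And>X Y. X \<in> \<C> \<Longrightarrow> Y \<in> \<C> \<Longrightarrow> X \<subseteq> Y \<or> Y \<subseteq> X"
      unfolding Chains_def relation_of_def by blast+
    show "\<exists>u\<in>Z. \<forall>C\<in>\<C>. C \<supseteq> u"
    proof (cases "\<C> = {}")
      case True
      have "A \<in> Z" using A meet unfolding Z_def by blast
      then show ?thesis using True by blast
    next
      case False
      have filt: "filtered \<C>" by (rule chain_filtered[OF False tot])
      have "\<Inter>\<C> \<inter> K \<noteq> {}" if "K \<in> \<G>" for K
        by (rule compact_upper_filtered[OF _ filt]) (use sub that meet Z_def in blast)+
      moreover have "scott_closed (\<Inter>\<C>)"
        by (rule scott_closed_Inter) (use sub Z_def in blast)
      ultimately have "\<Inter>\<C> \<in> Z" using False sub unfolding Z_def by blast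
      then show ?thesis by blast
    qed
  qed
  then obtain M where M: "M \<in> Z" and min: "\<And>C. C \<in> Z \<Longrightarrow> C \<subseteq> M \<Longrightarrow> C = M" by blast
  have Mc: "scott_closed M" and MA: "M \<subseteq> A" and MK: "\<And>K. K \<in> \<G> \<Longrightarrow> M \<inter> K \<noteq> {}"
    using M unfolding Z_def by blast+
  have eq: "{x. \<exists>k\<in>K. sup x k \<in> M} = M" if K: "K \<in> \<G>" for K
  proof (rule min)
    let ?N = "{x. \<exists>k\<in>K. sup x k \<in> M}"
    show NM: "?N \<subseteq> M" using scott_closed_down[OF Mc] sup_ge1 by blast
    \<comment> \<open>A point of \<open>M\<close> in a member of \<open>\<G>\<close> inside both
      \<open>K\<close> and \<open>K'\<close> is its own witness, since
      \<open>sup y y = y\<close>.\<close>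
    have "?N \<inter> K' \<noteq> {}" if K': "K' \<in> \<G>" for K'
    proof -
      obtain K'' where K'': "K'' \<in> \<G>" "K'' \<subseteq> K \<inter> K'"
        using \<G> K K' unfolding filtered_def by blast
      then obtain y where "y \<in> M" "y \<in> K''" using MK by blast
      moreover from this have "sup y y \<in> M" by simp
      ultimately show ?thesis using K'' by blast
    qed
    then show "?N \<in> Z"
      using scott_closed_sup_compact[OF Mc] meet[OF K] NM MA unfolding Z_def by blast
  qed
  have "M \<noteq> {}" using MK \<G> unfolding filtered_def by blast
  then obtain a where a: "a \<in> M" and max: "\<And>x. x \<in> M \<Longrightarrow> a \<le> x \<Longrightarrow> x = a"
    using scott_closed_maximal[OF Mc] by blast
  have "a \<in> K" if K: "K \<in> \<G>" for K
  proof -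
    obtain k where k: "k \<in> K" "sup a k \<in> M" using a eq[OF K] by blast
    then have "sup a k = a" using max sup_ge1 by blast
    then have "k \<le> a" by (metis sup_ge2)
    then show ?thesis using k(1) meet[OF K] compact_upper_up by blast
  qed
  then show ?thesis using a MA by blast
qed

section \<open>Compact upper sets under intersection and union\<close>

lemma compact_upper_atLeast: "compact_upper {x..}"
  unfolding compact_upper_def
proof (intro conjI ballI allI impI)
  fix \<C> :: "'a set set"
  assume "\<forall>C\<in>\<C>. scott_closed C \<and> C \<inter> {x..} \<noteq> {}"
  then have "\<forall>C\<in>\<C>. x \<in> C" using scott_closed_down by fastforce
  then show "\<Inter>\<C> \<inter> {x..} \<noteq> {}" by auto
qed auto

lemma compact_upper_UNIV: "compact_upper (UNIV :: 'a::complete_lattice set)"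
  using compact_upper_atLeast[of "bot :: 'a"] by (simp add: atLeast_def)

lemma filtered_image_mono:
  assumes "filtered \<C>" "\<And>C C'. C \<in> \<C> \<Longrightarrow> C' \<in> \<C> \<Longrightarrow> C \<subseteq> C' \<Longrightarrow> f C \<subseteq> f C'"
  shows "filtered (f ` \<C>)"
  unfolding filtered_def
proof (intro conjI ballI)
  show "f ` \<C> \<noteq> {}" using assms(1) by (simp add: filtered_def)
  fix X Y assume "X \<in> f ` \<C>" "Y \<in> f ` \<C>"
  then obtain C D where CD: "C \<in> \<C>" "D \<in> \<C>" "X = f C" "Y = f D" by blast
  with assms(1) obtain E where E: "E \<in> \<C>" "E \<subseteq> C" "E \<subseteq> D" unfolding filtered_def by blast
  have "f E \<subseteq> X" "f E \<subseteq> Y"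
    unfolding CD by (rule assms(2)[OF E(1) CD(1) E(2)], rule assms(2)[OF E(1) CD(2) E(3)])
  then show "\<exists>W\<in>f ` \<C>. W \<subseteq> X \<inter> Y" using E(1) by blast
qed

text \<open>Compactness is used twice. For \<open>K\<close> it yields one \<open>x\<close> that
  joins with some element of \<open>L\<close> into each \<open>C\<close>; for \<open>L\<close> it
  then yields one \<open>l\<close> that serves all \<open>C\<close>. The join of \<open>x\<close>
  and \<open>l\<close> lies in both upper sets.\<close>

lemma compact_upper_Int:
  assumes K: "compact_upper K" and L: "compact_upper L"
  shows "compact_upper (K \<inter> L)"
  unfolding compact_upper_def
proof (intro conjI ballI allI impI)
  fix x y assume "x \<in> K \<inter> L" "x \<le> y"
  then show "y \<in> K \<inter> L" using assms compact_upper_up by blast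
next
  fix \<C> :: "'a set set"
  assume filt: "filtered \<C>" and \<C>: "\<forall>C\<in>\<C>. scott_closed C \<and> C \<inter> (K \<inter> L) \<noteq> {}"
  let ?f = "\<lambda>C. {x. \<exists>l\<in>L. sup x l \<in> C}"
  have "\<Inter>(?f ` \<C>) \<inter> K \<noteq> {}"
  proof (rule compact_upper_filtered[OF K filtered_image_mono[OF filt]])
    fix X assume "X \<in> ?f ` \<C>"
    then obtain C where C: "C \<in> \<C>" "X = ?f C" by blast
    then obtain y where "y \<in> C" "y \<in> K" "y \<in> L" using \<C> by blast
    moreover from this have "sup y y \<in> C" by simp
    ultimately show "scott_closed X \<and> X \<inter> K \<noteq> {}"
      using C \<C> scott_closed_sup_compact[OF _ L] by blast
  qed blast
  then obtain x where x: "x \<in> K" "\<And>C. C \<in> \<C> \<Longrightarrow> \<exists>l\<in>L. sup x l \<in> C" by blast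
  let ?g = "\<lambda>C. {l. sup l x \<in> C}"
  have "\<Inter>(?g ` \<C>) \<inter> L \<noteq> {}"
  proof (rule compact_upper_filtered[OF L filtered_image_mono[OF filt]])
    fix X assume "X \<in> ?g ` \<C>"
    then obtain C where "C \<in> \<C>" "X = ?g C" by blast
    then show "scott_closed X \<and> X \<inter> L \<noteq> {}"
      using x(2)[of C] \<C> scott_closed_sup_preimage[of C x] by (auto simp: sup.commute)
  qed blast
  then obtain l where l: "l \<in> L" "\<And>C. C \<in> \<C> \<Longrightarrow> sup l x \<in> C" by blast
  have "sup l x \<in> K \<inter> L"
    using compact_upper_up[OF K x(1), of "sup l x"] compact_upper_up[OF L l(1), of "sup l x"] by simp
  with l(2) show "\<Inter>\<C> \<inter> (K \<inter> L) \<noteq> {}" by blast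
qed

text \<open>Each \<open>K\<close> meets the closed set \<open>\<Inter>\<C>\<close> by compactness;
  by well-filteredness so does their intersection.\<close>

lemma compact_upper_Inter_filtered:
  assumes \<G>: "filtered \<G>" and comp: "\<And>K. K \<in> \<G> \<Longrightarrow> compact_upper K"
  shows "compact_upper (\<Inter>\<G>)"
  unfolding compact_upper_def
proof (intro conjI ballI allI impI)
  fix x y assume "x \<in> \<Inter>\<G>" "x \<le> y"
  then show "y \<in> \<Inter>\<G>" using comp compact_upper_up by blast
next
  fix \<C> :: "'a set set"
  assume filt: "filtered \<C>" and \<C>: "\<forall>C\<in>\<C>. scott_closed C \<and> C \<inter> \<Inter>\<G> \<noteq> {}"
  show "\<Inter>\<C> \<inter> \<Inter>\<G> \<noteq> {}"
  proof (rule well_filtered[OF _ \<G>])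
    show "scott_closed (\<Inter>\<C>)" using \<C> by (intro scott_closed_Inter) blast
    fix K assume K: "K \<in> \<G>"
    have "\<Inter>\<C> \<inter> K \<noteq> {}"
      by (rule compact_upper_filtered[OF comp[OF K] filt]) (use \<C> K in blast)
    then show "compact_upper K \<and> \<Inter>\<C> \<inter> K \<noteq> {}" using comp K by blast
  qed
qed

text \<open>Any intersection is the filtered intersection of its finite subintersections; the empty
  one is \<open>UNIV\<close>, which is \<open>{bot..}\<close>.\<close>

lemma compact_upper_Inter:
  assumes comp: "\<And>K. K \<in> \<F> \<Longrightarrow> compact_upper K"
  shows "compact_upper (\<Inter>\<F>)"
proof -
  let ?\<G> = "Inter ` {G. finite G \<and> G \<subseteq> \<F>}"
  have "compact_upper (\<Inter>G)" if "finite G" "G \<subseteq> \<F>" for G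
    using that
    by (induction G rule: finite_induct) (auto simp: compact_upper_UNIV compact_upper_Int comp)
  moreover have "filtered ?\<G>"
    unfolding filtered_def
  proof (intro conjI ballI)
    show "?\<G> \<noteq> {}" by blast
    fix X Y assume "X \<in> ?\<G>" "Y \<in> ?\<G>"
    then obtain G H where "finite G" "G \<subseteq> \<F>" "X = \<Inter>G" "finite H" "H \<subseteq> \<F>" "Y = \<Inter>H" by blast
    then have "G \<union> H \<in> {G. finite G \<and> G \<subseteq> \<F>}" "\<Inter>(G \<union> H) \<subseteq> X \<inter> Y" by auto
    then show "\<exists>W\<in>?\<G>. W \<subseteq> X \<inter> Y" by blast
  qed
  ultimately have "compact_upper (\<Inter>?\<G>)"
    by (intro compact_upper_Inter_filtered) auto
  moreover have "\<Inter>?\<G> = \<Inter>\<F>"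
  proof
    show "\<Inter>?\<G> \<subseteq> \<Inter>\<F>"
    proof (intro subsetI InterI)
      fix x K assume x: "x \<in> \<Inter>?\<G>" and "K \<in> \<F>"
      then have "\<Inter>{K} \<in> ?\<G>" by (intro imageI) simp
      with x show "x \<in> K" by auto
    qed
  qed blast
  ultimately show ?thesis by simp
qed

text \<open>If \<open>C\<close> missed \<open>K\<close> and \<open>D\<close> missed
  \<open>L\<close>, a member of \<open>\<C>\<close> inside both would miss the union. So all members
  meet the same one of the two.\<close>

lemma compact_upper_Un:
  assumes K: "compact_upper K" and L: "compact_upper L"
  shows "compact_upper (K \<union> L)"
  unfolding compact_upper_def
proof (intro conjI ballI allI impI)
  fix x y assume "x \<in> K \<union> L" "x \<le> y"
  then show "y \<in> K \<union> L" using assms compact_upper_up by blast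
next
  fix \<C> :: "'a set set"
  assume filt: "filtered \<C>" and \<C>: "\<forall>C\<in>\<C>. scott_closed C \<and> C \<inter> (K \<union> L) \<noteq> {}"
  have "(\<forall>C\<in>\<C>. C \<inter> K \<noteq> {}) \<or> (\<forall>C\<in>\<C>. C \<inter> L \<noteq> {})"
  proof (rule ccontr)
    assume "\<not> ?thesis"
    then obtain C D where "C \<in> \<C>" "C \<inter> K = {}" "D \<in> \<C>" "D \<inter> L = {}" by blast
    moreover from this obtain E where "E \<in> \<C>" "E \<subseteq> C \<inter> D"
      using filt unfolding filtered_def by blast
    ultimately show False using \<C> by blast
  qed
  then show "\<Inter>\<C> \<inter> (K \<union> L) \<noteq> {}"
    using compact_upper_filtered[OF K filt] compact_upper_filtered[OF L filt] \<C> by blast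
qed

section \<open>The frame of compact upper sets\<close>

text \<open>The Smyth power construction, with the empty set as top element. An injective
  \<open>\<phi>\<close> moves the carrier to another type.\<close>

definition smyth :: "('a::complete_lattice set \<Rightarrow> 'b) \<Rightarrow> 'b gorder" where
  "smyth \<phi> = \<lparr>carrier = \<phi> ` Collect compact_upper, eq = (=),
             le = \<lambda>a b. inv \<phi> b \<subseteq> inv \<phi> a\<rparr>"

lemma (in weak_partial_order) closedin_scott_topology:
  "closedin (scott_topology L) F \<longleftrightarrow>
     F \<subseteq> carrier L \<and> (\<forall>x\<in>F. \<forall>y\<in>carrier L. y \<sqsubseteq> x \<longrightarrow> y \<in> F) \<and>
     (\<forall>D s. directed_subset L D \<longrightarrow> is_lub L s D \<longrightarrow> D \<subseteq> F \<longrightarrow> s \<in> F)"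
proof -
  have car: "D \<subseteq> carrier L" "s \<in> carrier L" if "directed_subset L D" "is_lub L s D" for D s
    using that by (auto simp: directed_subset_def least_def Upper_def)
  have "(\<forall>x\<in>carrier L - F. \<forall>y\<in>carrier L. x \<sqsubseteq> y \<longrightarrow> y \<in> carrier L - F) \<longleftrightarrow>
      (\<forall>x\<in>F. \<forall>y\<in>carrier L. y \<sqsubseteq> x \<longrightarrow> y \<in> F)" if "F \<subseteq> carrier L"
    using that by blast
  moreover have "(\<forall>D s. directed_subset L D \<longrightarrow> is_lub L s D \<longrightarrow> s \<in> carrier L - F \<longrightarrow>
        D \<inter> (carrier L - F) \<noteq> {}) \<longleftrightarrow>
      (\<forall>D s. directed_subset L D \<longrightarrow> is_lub L s D \<longrightarrow> D \<subseteq> F \<longrightarrow> s \<in> F)"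
    using car by blast
  ultimately show ?thesis
    unfolding closedin_def topspace_scott_topology openin_scott_topology scott_open_iff by auto
qed

lemma is_lub_iff:
  assumes "A \<subseteq> carrier L"
  shows "is_lub L s A \<longleftrightarrow> s \<in> carrier L \<and> (\<forall>x\<in>A. x \<sqsubseteq>\<^bsub>L\<^esub> s) \<and>
    (\<forall>u\<in>carrier L. (\<forall>x\<in>A. x \<sqsubseteq>\<^bsub>L\<^esub> u) \<longrightarrow> s \<sqsubseteq>\<^bsub>L\<^esub> u)"
  using assms unfolding least_def Upper_def by blast

lemma is_glb_iff:
  assumes "A \<subseteq> carrier L"
  shows "is_glb L i A \<longleftrightarrow> i \<in> carrier L \<and> (\<forall>x\<in>A. i \<sqsubseteq>\<^bsub>L\<^esub> x) \<and>
    (\<forall>l\<in>carrier L. (\<forall>x\<in>A. l \<sqsubseteq>\<^bsub>L\<^esub> x) \<longrightarrow> l \<sqsubseteq>\<^bsub>L\<^esub> i)"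
  using assms unfolding greatest_def Lower_def by blast

section \<open>The frame structure\<close>

context
  fixes \<phi> :: "'a::complete_lattice set \<Rightarrow> 'b"
  assumes inj: "inj \<phi>"
begin

lemma carrier_smyth [simp]: "carrier (smyth \<phi>) = \<phi> ` Collect compact_upper"
  by (simp add: smyth_def)

lemma eq_smyth [simp]: "eq (smyth \<phi>) = (=)"
  by (simp add: smyth_def)

lemma le_smyth [simp]: "\<phi> K \<sqsubseteq>\<^bsub>smyth \<phi>\<^esub> \<phi> L \<longleftrightarrow> L \<subseteq> K"
  by (simp add: smyth_def inv_f_f[OF inj])

lemma image_smyth_eq_iff [simp]: "\<phi> K = \<phi> L \<longleftrightarrow> K = L"
  by (rule inj_eq[OF inj])

lemma partial_order_smyth: "partial_order (smyth \<phi>)"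
  by unfold_locales auto

interpretation S: partial_order "smyth \<phi>"
  by (rule partial_order_smyth)

lemma is_lub_smyth_Inter:
  assumes "\<F> \<subseteq> Collect compact_upper"
  shows "is_lub (smyth \<phi>) (\<phi> (\<Inter>\<F>)) (\<phi> ` \<F>)"
proof -
  have "compact_upper (\<Inter>\<F>)" using assms by (intro compact_upper_Inter) blast
  then show ?thesis
    using assms by (subst is_lub_iff) (auto simp: inj_image_subset_iff[OF inj])
qed

lemma is_lub_smyth_iff:
  assumes "\<F> \<subseteq> Collect compact_upper"
  shows "is_lub (smyth \<phi>) s (\<phi> ` \<F>) \<longleftrightarrow> s = \<phi> (\<Inter>\<F>)"
  using S.least_unique is_lub_smyth_Inter[OF assms] by blast

lemma is_glb_smyth_Un:
  assumes "compact_upper K" "compact_upper L"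
  shows "is_glb (smyth \<phi>) (\<phi> (K \<union> L)) {\<phi> K, \<phi> L}"
  using assms compact_upper_Un[OF assms] by (subst is_glb_iff) auto

lemma complete_lattice_smyth: "Complete_Lattice.complete_lattice (smyth \<phi>)"
proof
  fix A assume "A \<subseteq> carrier (smyth \<phi>)"
  then obtain \<F> where \<F>: "\<F> \<subseteq> Collect compact_upper" "A = \<phi> ` \<F>"
    by (auto simp: subset_image_iff)
  then show "\<exists>s. is_lub (smyth \<phi>) s A" using is_lub_smyth_Inter by blast
  \<comment> \<open>An infinite union need not be compact, so the infimum is the intersection of all
    compact upper sets containing every member.\<close>
  let ?B = "{L. compact_upper L \<and> (\<forall>K\<in>\<F>. K \<subseteq> L)}"
  have "compact_upper (\<Inter>?B)" by (intro compact_upper_Inter) blast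
  then have "is_glb (smyth \<phi>) (\<phi> (\<Inter>?B)) A"
    unfolding \<F>(2) using \<F>(1)
    by (subst is_glb_iff) (auto simp: inj_image_subset_iff[OF inj])
  then show "\<exists>i. is_glb (smyth \<phi>) i A" by blast
qed

lemma complete_heyting_algebra_smyth: "complete_heyting_algebra (smyth \<phi>)"
proof -
  interpret C: Complete_Lattice.complete_lattice "smyth \<phi>" by (rule complete_lattice_smyth)
  have Sup: "\<Squnion>\<^bsub>smyth \<phi>\<^esub>(\<phi> ` \<F>) = \<phi> (\<Inter>\<F>)" if "\<F> \<subseteq> Collect compact_upper" for \<F>
    unfolding Lattice.sup_def using that by (intro some_equality) (simp_all add: is_lub_smyth_iff)
  have meet: "\<phi> K \<sqinter>\<^bsub>smyth \<phi>\<^esub> \<phi> L = \<phi> (K \<union> L)" if "compact_upper K" "compact_upper L" for K L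
    unfolding Lattice.meet_def Lattice.inf_def
    using is_glb_smyth_Un[OF that] S.greatest_unique by (intro some_equality) blast+
  show ?thesis
  proof
    fix a B assume "a \<in> carrier (smyth \<phi>)" "B \<subseteq> carrier (smyth \<phi>)"
    then obtain K \<F> where K: "compact_upper K" "a = \<phi> K"
      and \<F>: "\<F> \<subseteq> Collect compact_upper" "B = \<phi> ` \<F>"
      by (auto simp: subset_image_iff)
    have "compact_upper (\<Inter>\<F>)" using \<F>(1) by (intro compact_upper_Inter) blast
    then have "a \<sqinter>\<^bsub>smyth \<phi>\<^esub> \<Squnion>\<^bsub>smyth \<phi>\<^esub>B = \<phi> (K \<union> \<Inter>\<F>)"
      using K \<F> by (simp add: Sup meet)
    \<comment> \<open>The frame law comes down to distributivity of union over intersection; for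
      empty \<open>\<F>\<close> both sides are \<open>UNIV\<close>.\<close>
    also have "K \<union> \<Inter>\<F> = \<Inter>((\<union>) K ` \<F>)" by blast
    also have "\<phi> (\<Inter>((\<union>) K ` \<F>)) = \<Squnion>\<^bsub>smyth \<phi>\<^esub>(\<phi> ` (\<union>) K ` \<F>)"
      using K(1) \<F>(1) by (intro Sup[symmetric]) (auto intro: compact_upper_Un)
    also have "\<phi> ` (\<union>) K ` \<F> = (\<lambda>b. a \<sqinter>\<^bsub>smyth \<phi>\<^esub> b) ` B"
      unfolding \<F>(2) image_image by (rule image_cong) (use K \<F>(1) meet in auto)
    finally show "a \<sqinter>\<^bsub>smyth \<phi>\<^esub> \<Squnion>\<^bsub>smyth \<phi>\<^esub>B = \<Squnion>\<^bsub>smyth \<phi>\<^esub>((\<lambda>b. a \<sqinter>\<^bsub>smyth \<phi>\<^esub> b) ` B)" .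
  qed
qed

section \<open>Scott closed sets of the frame\<close>

lemma directed_subset_smyth:
  assumes "directed_subset (smyth \<phi>) D"
  obtains \<F> where "\<F> \<subseteq> Collect compact_upper" "D = \<phi> ` \<F>" "filtered \<F>"
proof -
  obtain \<F> where \<F>: "\<F> \<subseteq> Collect compact_upper" "D = \<phi> ` \<F>"
    using assms unfolding directed_subset_def by (auto simp: subset_image_iff)
  moreover have "filtered \<F>"
    using assms unfolding \<F>(2) directed_subset_def filtered_def by auto
  ultimately show ?thesis using that by blast
qed

text \<open>Directed sets of the frame are filtered families with the intersection as supremum, so
  closure under suprema is well-filteredness.\<close>

lemma closedin_smyth_meeting:
  assumes E: "scott_closed E"
  shows "closedin (scott_topology (smyth \<phi>)) (\<phi> ` {K. compact_upper K \<and> E \<inter> K \<noteq> {}})"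
  unfolding S.closedin_scott_topology
proof (intro conjI ballI allI impI)
  fix D s
  assume "directed_subset (smyth \<phi>) D" and s: "is_lub (smyth \<phi>) s D"
    and D: "D \<subseteq> \<phi> ` {K. compact_upper K \<and> E \<inter> K \<noteq> {}}"
  then obtain \<F> where \<F>: "\<F> \<subseteq> Collect compact_upper" "D = \<phi> ` \<F>" "filtered \<F>"
    by (auto elim: directed_subset_smyth)
  then have s': "s = \<phi> (\<Inter>\<F>)" using s is_lub_smyth_iff by blast
  have "E \<inter> \<Inter>\<F> \<noteq> {}"
    using D \<F>(1) unfolding \<F>(2)
    by (intro well_filtered[OF E \<F>(3)]) (auto simp: inj_image_subset_iff[OF inj])
  moreover have "compact_upper (\<Inter>\<F>)" using \<F>(1) by (intro compact_upper_Inter) blast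
  ultimately show "s \<in> \<phi> ` {K. compact_upper K \<and> E \<inter> K \<noteq> {}}" using s' by blast
next
  fix a b assume "a \<in> \<phi> ` {K. compact_upper K \<and> E \<inter> K \<noteq> {}}"
    and b: "b \<in> carrier (smyth \<phi>)" and le: "b \<sqsubseteq>\<^bsub>smyth \<phi>\<^esub> a"
  then obtain K where K: "a = \<phi> K" "E \<inter> K \<noteq> {}" by blast
  from b obtain L where L: "b = \<phi> L" "compact_upper L" by auto
  have "K \<subseteq> L" using le K L by simp
  with K L show "b \<in> \<phi> ` {K. compact_upper K \<and> E \<inter> K \<noteq> {}}" by blast
qed auto

text \<open>Sending \<open>x\<close> to \<open>{x..}\<close> is Scott continuous, as the
  \<open>{d..}\<close> for \<open>d\<close> in \<open>D\<close> intersect in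
  \<open>{Sup D..}\<close>.\<close>

lemma scott_closed_principal_vimage:
  assumes "closedin (scott_topology (smyth \<phi>)) F"
  shows "scott_closed {x. \<phi> {x..} \<in> F}"
  unfolding scott_closed_def
proof (intro conjI ballI allI impI)
  fix x y assume "x \<in> {x. \<phi> {x..} \<in> F}" "y \<le> x"
  moreover from this have "\<phi> {y..} \<sqsubseteq>\<^bsub>smyth \<phi>\<^esub> \<phi> {x..}" by simp
  ultimately show "y \<in> {x. \<phi> {x..} \<in> F}"
    using assms compact_upper_atLeast[of y] unfolding S.closedin_scott_topology carrier_smyth
    by blast
next
  fix D :: "'a set" assume D: "updirected D" "D \<subseteq> {x. \<phi> {x..} \<in> F}"
  let ?\<F> = "atLeast ` D"
  have sub: "?\<F> \<subseteq> Collect compact_upper" by (auto simp: compact_upper_atLeast)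
  have "directed_subset (smyth \<phi>) (\<phi> ` ?\<F>)"
    using D(1) sub unfolding directed_subset_def updirected_def by (simp add: image_subset_iff)
  moreover have "\<Inter>?\<F> = {Sup D..}" by (auto simp: Sup_le_iff)
  then have "is_lub (smyth \<phi>) (\<phi> {Sup D..}) (\<phi> ` ?\<F>)" using is_lub_smyth_Inter[OF sub] by simp
  moreover have "\<phi> ` ?\<F> \<subseteq> F" using D(2) by auto
  ultimately show "Sup D \<in> {x. \<phi> {x..} \<in> F}"
    using assms unfolding S.closedin_scott_topology by blast
qed

lemma closedin_smyth_principal:
  assumes "K \<in> carrier (smyth \<phi>)"
  shows "closedin (scott_topology (smyth \<phi>)) {L \<in> carrier (smyth \<phi>). L \<sqsubseteq>\<^bsub>smyth \<phi>\<^esub> K}"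
  unfolding S.closedin_scott_topology
proof (intro conjI ballI allI impI)
  fix D s assume "directed_subset (smyth \<phi>) D" "is_lub (smyth \<phi>) s D"
    and "D \<subseteq> {L \<in> carrier (smyth \<phi>). L \<sqsubseteq>\<^bsub>smyth \<phi>\<^esub> K}"
  with assms show "s \<in> {L \<in> carrier (smyth \<phi>). L \<sqsubseteq>\<^bsub>smyth \<phi>\<^esub> K}"
    unfolding least_def Upper_def by blast
qed (use assms S.le_trans in blast)+

text \<open>The closed set of all compact upper sets meeting \<open>E\<close> is irreducible, as its principal
  members are dense in it. A generic point would be a set of upper bounds of \<open>E\<close>
  that meets \<open>E\<close>, giving \<open>E\<close> a greatest element.\<close>

lemma smyth_not_sober:
  fixes E :: "'a set"
  assumes E: "scott_closed E" "E \<noteq> {}"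
    and irr: "\<And>F1 F2. scott_closed F1 \<Longrightarrow> scott_closed F2 \<Longrightarrow> E \<subseteq> F1 \<union> F2 \<Longrightarrow> E \<subseteq> F1 \<or> E \<subseteq> F2"
    and no_greatest: "\<And>e. e \<in> E \<Longrightarrow> \<exists>x\<in>E. \<not> x \<le> e"
  shows "\<not> sober_space (scott_topology (smyth \<phi>))"
proof
  assume sober: "sober_space (scott_topology (smyth \<phi>))"
  define \<A> where "\<A> = \<phi> ` {K. compact_upper K \<and> E \<inter> K \<noteq> {}}"
  have principal: "\<phi> {x..} \<in> \<A>" if "x \<in> E" for x
    using that compact_upper_atLeast unfolding \<A>_def by auto
  have closed: "closedin (scott_topology (smyth \<phi>)) \<A>"
    unfolding \<A>_def by (rule closedin_smyth_meeting[OF E(1)])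
  have dense: "\<A> \<subseteq> F" if F: "closedin (scott_topology (smyth \<phi>)) F" "E \<subseteq> {x. \<phi> {x..} \<in> F}" for F
  proof
    fix a assume "a \<in> \<A>"
    then obtain K x where K: "compact_upper K" "a = \<phi> K" and x: "x \<in> E" "x \<in> K"
      unfolding \<A>_def by blast
    have "{x..} \<subseteq> K" using compact_upper_up[OF K(1) x(2)] by auto
    then have "a \<sqsubseteq>\<^bsub>smyth \<phi>\<^esub> \<phi> {x..}" using K(2) by simp
    moreover have "\<phi> {x..} \<in> F" using F(2) x(1) by blast
    moreover have "a \<in> carrier (smyth \<phi>)" using K by simp
    ultimately show "a \<in> F" using F(1) unfolding S.closedin_scott_topology by blast
  qed
  have "irreducible_in (scott_topology (smyth \<phi>)) \<A>"
    unfolding irreducible_in_def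
  proof (intro conjI allI impI)
    show "\<A> \<subseteq> topspace (scott_topology (smyth \<phi>))"
      using closed by (rule closedin_subset)
    show "\<A> \<noteq> {}" using E(2) principal by blast
    fix F1 F2
    assume F: "closedin (scott_topology (smyth \<phi>)) F1" "closedin (scott_topology (smyth \<phi>)) F2"
      and "\<A> \<subseteq> F1 \<union> F2"
    then have "E \<subseteq> {x. \<phi> {x..} \<in> F1} \<union> {x. \<phi> {x..} \<in> F2}" using principal by blast
    then have "E \<subseteq> {x. \<phi> {x..} \<in> F1} \<or> E \<subseteq> {x. \<phi> {x..} \<in> F2}"
      by (intro irr scott_closed_principal_vimage F)
    then show "\<A> \<subseteq> F1 \<or> \<A> \<subseteq> F2" using dense F by blast
  qed
  then obtain a where a: "a \<in> carrier (smyth \<phi>)"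
    and \<A>: "\<A> = scott_topology (smyth \<phi>) closure_of {a}"
    using sober closed unfolding sober_space_def S.topspace_scott_topology by blast
  then have "a \<in> \<A>" by (simp add: closure_of_def)
  then obtain K e where K: "compact_upper K" "a = \<phi> K" and e: "e \<in> E" "e \<in> K"
    unfolding \<A>_def by blast
  have "\<A> \<subseteq> {b \<in> carrier (smyth \<phi>). b \<sqsubseteq>\<^bsub>smyth \<phi>\<^esub> a}"
    unfolding \<A> by (rule closure_of_minimal[OF _ closedin_smyth_principal[OF a]]) (use a in simp)
  then have "\<phi> {x..} \<sqsubseteq>\<^bsub>smyth \<phi>\<^esub> \<phi> K" if "x \<in> E" for x
    using principal[OF that] K(2) by blast
  then have "K \<subseteq> {x..}" if "x \<in> E" for x using that by simp
  then have "x \<le> e" if "x \<in> E" for x using e(2) that by auto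
  then show False using no_greatest[OF e(1)] by blast
qed

end

section \<open>A non-sober complete lattice\<close>

text \<open>The points \<open>p\<close> become elements \<open>Peak p\<close> below the top, each of which is the supremum of its own
  chain \<open>Chain p 0 < Chain p 1 < \<dots>\<close>. Every pair \<open>(p, q)\<close> of points is given, for each height \<open>k\<close>,
  neighbours \<open>Lnode p q k i\<close> of \<open>p\<close> and \<open>Rnode p q k h\<close> of \<open>q\<close>, and these two have the common
  neighbour \<open>Link p q k i h\<close> at height \<open>h i\<close>. As the points are generated freely, two chains have at
  most one \<open>Peak\<close> element above both, which is what makes all suprema exist.\<close>

datatype point = Root
  | Lnode point point nat nat
  | Rnode point point nat "nat \<Rightarrow> nat"
  | Link point point nat nat "nat \<Rightarrow> nat"

text \<open>\<open>near p n q\<close> will mean that \<open>Chain p n\<close> lies below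
  \<open>Peak q\<close>. The bounds on \<open>n\<close> are inequalities so that the relation is
  downward closed in the height.\<close>

inductive near :: "point \<Rightarrow> nat \<Rightarrow> point \<Rightarrow> bool" where
  near_self: "near p n p"
| near_Lnode: "n \<le> k \<Longrightarrow> near p n (Lnode p q k i)"
| near_Rnode: "n \<le> k \<Longrightarrow> near q n (Rnode p q k h)"
| near_Link_Lnode: "n \<le> h i \<Longrightarrow> near (Lnode p q k i) n (Link p q k i h)"
| near_Link_Rnode: "n \<le> h i \<Longrightarrow> near (Rnode p q k h) n (Link p q k i h)"

section \<open>Bounded heights and uniqueness of common neighbours\<close>

lemma near_antimono: "near p n q \<Longrightarrow> m \<le> n \<Longrightarrow> near p m q"
  by (induction rule: near.induct) (auto intro!: near.intros)

text \<open>The datatype size will not do: it is the same for \<open>Link p q k i h\<close> and for its two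
  neighbours of the other kinds.\<close>

primrec rank :: "point \<Rightarrow> nat" where
  "rank Root = 0"
| "rank (Lnode p q k i) = Suc (rank p + rank q)"
| "rank (Rnode p q k h) = Suc (rank p + rank q)"
| "rank (Link p q k i h) = Suc (Suc (rank p + rank q))"

lemma near_rank: "near p n q \<Longrightarrow> p = q \<or> rank p < rank q"
  by (induction rule: near.induct) auto

text \<open>Nearness to a different point is capped in height by \<open>k\<close> or
  \<open>h i\<close>. This makes \<open>Peak p\<close> the least bound of its chain.\<close>

lemma near_all_heights:
  assumes "\<And>m. \<exists>n\<ge>m. near p n q"
  shows "p = q"
proof (rule ccontr)
  assume ne: "p \<noteq> q"
  have near: "near p n q" for n using assms near_antimono by blast
  have "\<exists>b. \<forall>n. near p n q \<longrightarrow> n \<le> b"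
  proof (cases q)
    case Root
    then show ?thesis using near[of 0] ne by (auto elim: near.cases)
  next
    case (Lnode p' q' k i)
    have "near p n q \<longrightarrow> n \<le> k" for n using ne unfolding Lnode by (auto elim: near.cases)
    then show ?thesis by blast
  next
    case (Rnode p' q' k h)
    have "near p n q \<longrightarrow> n \<le> k" for n using ne unfolding Rnode by (auto elim: near.cases)
    then show ?thesis by blast
  next
    case (Link p' q' k i h)
    have "near p n q \<longrightarrow> n \<le> h i" for n using ne unfolding Link by (auto elim: near.cases)
    then show ?thesis by blast
  qed
  then show False using near not_less_eq_eq by blast
qed

text \<open>Only one point other than itself is near an \<open>Lnode\<close> or an
  \<open>Rnode\<close>, and none is near \<open>Root\<close>, so \<open>z\<close> is a
  \<open>Link\<close>.\<close>

lemma near_two_parents: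
  assumes "near x a z" "near y b z" "x \<noteq> y" "x \<noteq> z" "y \<noteq> z"
  obtains p q k i h where "z = Link p q k i h"
    "x = Lnode p q k i \<and> y = Rnode p q k h \<or> x = Rnode p q k h \<and> y = Lnode p q k i"
  using assms by (cases z) (auto elim!: near.cases)

lemma Lnode_neq_Rnode_neq: "Lnode p q k i \<noteq> q" "Rnode p q k h \<noteq> p"
  by (rule notI, drule arg_cong[where f = rank], simp)+

text \<open>The only other point near \<open>Rnode p q k h\<close> is \<open>q\<close>, and the only
  one near \<open>Lnode p q k i\<close> is \<open>p\<close>; by rank neither is the opposite
  parent.\<close>

lemma parents_not_near:
  assumes "near x a z" "near y b z" "x \<noteq> y" "x \<noteq> z" "y \<noteq> z"
  shows "\<not> near x c y"
  using assms
proof (rule near_two_parents)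
  fix p q k i h
  assume "x = Lnode p q k i \<and> y = Rnode p q k h \<or> x = Rnode p q k h \<and> y = Lnode p q k i"
  then show ?thesis using Lnode_neq_Rnode_neq by (auto elim!: near.cases)
qed

text \<open>If \<open>p\<close> and \<open>q\<close> both differ from \<open>x\<close> and
  \<open>y\<close>, they are \<open>Link\<close> points, and their parents \<open>x\<close> and
  \<open>y\<close> together carry all five parameters of a \<open>Link\<close>. Otherwise one of
  \<open>x\<close> and \<open>y\<close> is near the other, and rank together with
  \<open>parents_not_near\<close> excludes a second common target.\<close>

lemma near_unique:
  assumes p: "near x a p" "near y b p" and q: "near x c q" "near y d q" and "x \<noteq> y"
  shows "p = q"
proof (cases "p \<in> {x, y} \<or> q \<in> {x, y}")
  case False
  then obtain u v k i h u' v' k' i' h' where "p = Link u v k i h" "q = Link u' v' k' i' h'"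
    and "x = Lnode u v k i \<and> y = Rnode u v k h \<or> x = Rnode u v k h \<and> y = Lnode u v k i"
    and "x = Lnode u' v' k' i' \<and> y = Rnode u' v' k' h' \<or> x = Rnode u' v' k' h' \<and> y = Lnode u' v' k' i'"
    using near_two_parents[OF p \<open>x \<noteq> y\<close>] near_two_parents[OF q \<open>x \<noteq> y\<close>] by (metis insertCI)
  then show ?thesis by auto
next
  case True
  have "near x e y \<Longrightarrow> near y f x \<Longrightarrow> False" for e f
    using near_rank[of x e y] near_rank[of y f x] \<open>x \<noteq> y\<close> by auto
  moreover have "\<not> near x e y" "\<not> near y e x" if "near x a' z" "near y b' z" "z \<noteq> x" "z \<noteq> y" for e z a' b'
    using parents_not_near[of x a' z y b' e] parents_not_near[of y b' z x a' e] that \<open>x \<noteq> y\<close> by auto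
  ultimately show ?thesis using True p q by (metis insert_iff empty_iff)
qed

section \<open>The complete lattice of chains and peaks\<close>

datatype lat = Bot | Chain point nat | Peak point | Top

instantiation lat :: order
begin

fun less_eq_lat :: "lat \<Rightarrow> lat \<Rightarrow> bool" where
  "Bot \<le> v \<longleftrightarrow> True"
| "u \<le> Top \<longleftrightarrow> True"
| "Chain p m \<le> Chain q n \<longleftrightarrow> p = q \<and> m \<le> n"
| "Chain p m \<le> Peak q \<longleftrightarrow> near p m q"
| "Peak p \<le> Peak q \<longleftrightarrow> p = q"
| "(u :: lat) \<le> v \<longleftrightarrow> False"

definition less_lat :: "lat \<Rightarrow> lat \<Rightarrow> bool" where
  "less_lat u v \<longleftrightarrow> u \<le> v \<and> \<not> v \<le> u"

instance
proof
  fix u v w :: lat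
  show "u < v \<longleftrightarrow> u \<le> v \<and> \<not> v \<le> u" by (fact less_lat_def)
  show "u \<le> u" by (cases u) auto
  show "u \<le> v \<Longrightarrow> v \<le> w \<Longrightarrow> u \<le> w"
    by (cases u; cases v; cases w) (auto intro: near_antimono)
  show "u \<le> v \<Longrightarrow> v \<le> u \<Longrightarrow> u = v"
    by (cases u; cases v) auto
qed

end

lemma Chain_le_iff: "Chain p m \<le> v \<longleftrightarrow>
    v = Top \<or> (\<exists>n\<ge>m. v = Chain p n) \<or> (\<exists>q. v = Peak q \<and> near p m q)"
  by (cases v) auto

lemma Peak_le_iff: "Peak p \<le> v \<longleftrightarrow> v = Peak p \<or> v = Top"
  by (cases v) auto

lemma Top_le_iff: "Top \<le> v \<longleftrightarrow> v = Top"
  by (cases v) auto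

lemma le_Top: "v \<le> Top"
  by (cases v) auto

lemma Chain_unbounded_le:
  assumes "\<And>m. \<exists>n\<ge>m. Chain p n \<le> u"
  shows "Peak p \<le> u"
proof (cases u)
  case (Peak q)
  then have "p = q" using assms by (intro near_all_heights) auto
  then show ?thesis using Peak by simp
next
  case (Chain q n)
  then show ?thesis using assms[of "Suc n"] by auto
qed (use assms in auto)

lemma two_chains_le:
  assumes "Chain p m \<le> u" "Chain q n \<le> u" "p \<noteq> q" "Chain p m \<le> Peak r" "Chain q n \<le> Peak r"
  shows "Peak r \<le> u"
  using assms near_unique by (cases u) auto

lemma below_Peak:
  assumes "u \<noteq> Top"
  obtains p where "u \<le> Peak p"
  using assms near_self by (cases u) auto

text \<open>Let \<open>S\<close> have no greatest element. If no peak bounds \<open>S\<close>, the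
  supremum is \<open>Top\<close>, since every other element lies below a peak. If
  \<open>Peak r\<close> bounds \<open>S\<close>, only \<open>Bot\<close> and chain elements occur:
  two different chains force \<open>Peak r\<close>, a single chain of \<open>p\<close> without
  highest member forces \<open>Peak p\<close>, and the empty set gives \<open>Bot\<close>.\<close>

lemma lat_lub_exists:
  fixes S :: "lat set"
  shows "\<exists>s. (\<forall>x\<in>S. x \<le> s) \<and> (\<forall>u. (\<forall>x\<in>S. x \<le> u) \<longrightarrow> s \<le> u)"
proof (cases "\<exists>s\<in>S. \<forall>x\<in>S. x \<le> s")
  case True
  then show ?thesis by blast
next
  case no_greatest: False
  show ?thesis
  proof (cases "\<exists>r. \<forall>x\<in>S. x \<le> Peak r")
    case False
    have "Top \<le> u" if u: "\<forall>x\<in>S. x \<le> u" for u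
    proof (rule ccontr)
      assume "\<not> Top \<le> u"
      then obtain r where "u \<le> Peak r" by (metis below_Peak order_refl)
      then show False using u False order_trans by blast
    qed
    then show ?thesis using le_Top by blast
  next
    case True
    then obtain r where r: "\<forall>x\<in>S. x \<le> Peak r" by blast
    have chain: "x = Bot \<or> (\<exists>q n. x = Chain q n)" if x: "x \<in> S" for x
    proof (cases x)
      case (Peak q)
      then have "x = Peak r" using r x by fastforce
      then show ?thesis using no_greatest r x by blast
    next
      case Top
      then show ?thesis using r x by fastforce
    qed auto
    show ?thesis
    proof (cases "S = {}")
      case True
      then show ?thesis by (intro exI[of _ Bot]) simp
    next
      case False
      then obtain s where "s \<in> S" by blast
      then obtain x where "x \<in> S" "\<not> x \<le> s" using no_greatest by blast
      then have x: "x \<in> S" "x \<noteq> Bot" by auto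
      then obtain p m where pm: "Chain p m \<in> S" using chain by blast
      show ?thesis
      proof (cases "\<exists>q n. Chain q n \<in> S \<and> q \<noteq> p")
        case True
        then obtain q n where "Chain q n \<in> S" "q \<noteq> p" by blast
        then have "Peak r \<le> u" if "\<forall>x\<in>S. x \<le> u" for u
          using that r pm by (intro two_chains_le[of p m u q n r]) auto
        then show ?thesis using r by blast
      next
        case False
        then have column: "x = Bot \<or> (\<exists>n. x = Chain p n)" if "x \<in> S" for x
          using chain[OF that] that by blast
        have "\<exists>n\<ge>k. Chain p n \<in> S" for k
        proof (rule ccontr)
          assume "\<not> ?thesis"
          then have bound: "\<forall>n. Chain p n \<in> S \<longrightarrow> n \<le> k" by (meson nat_le_linear)
          let ?g = "GREATEST n. Chain p n \<in> S"
          have "Chain p ?g \<in> S" by (rule GreatestI_nat[of "\<lambda>n. Chain p n \<in> S", OF pm]) (use bound in blast)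
          moreover have "n \<le> ?g" if "Chain p n \<in> S" for n
            by (rule Greatest_le_nat[of "\<lambda>n. Chain p n \<in> S", OF that]) (use bound in blast)
          then have "x \<le> Chain p ?g" if "x \<in> S" for x using column[OF that] that by auto
          ultimately show False using no_greatest by blast
        qed
        then have "Peak p \<le> u" if "\<forall>x\<in>S. x \<le> u" for u
          using that by (intro Chain_unbounded_le) blast
        moreover have "x \<le> Peak p" if "x \<in> S" for x
          using column[OF that] near_self by auto
        ultimately show ?thesis by blast
      qed
    qed
  qed
qed

instantiation lat :: complete_lattice
begin

definition Sup_lat :: "lat set \<Rightarrow> lat" where
  "Sup_lat S = (SOME s. (\<forall>x\<in>S. x \<le> s) \<and> (\<forall>u. (\<forall>x\<in>S. x \<le> u) \<longrightarrow> s \<le> u))"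
definition Inf_lat :: "lat set \<Rightarrow> lat" where
  "Inf_lat S = Sup {l. \<forall>x\<in>S. l \<le> x}"
definition sup_lat :: "lat \<Rightarrow> lat \<Rightarrow> lat" where
  "sup_lat u v = Sup {u, v}"
definition inf_lat :: "lat \<Rightarrow> lat \<Rightarrow> lat" where
  "inf_lat u v = Inf {u, v}"
definition top_lat :: lat where
  "top_lat = Inf {}"
definition bot_lat :: lat where
  "bot_lat = Sup {}"

instance
proof -
  have upper: "x \<le> Sup S" if "x \<in> S" for x :: lat and S
    using someI_ex[OF lat_lub_exists[of S]] that unfolding Sup_lat_def by blast
  have least: "Sup S \<le> u" if "\<And>x. x \<in> S \<Longrightarrow> x \<le> u" for u :: lat and S
    using someI_ex[OF lat_lub_exists[of S]] that unfolding Sup_lat_def by blast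
  show "OFCLASS(lat, complete_lattice_class)"
    by standard
      (auto simp: sup_lat_def inf_lat_def Inf_lat_def top_lat_def bot_lat_def intro: upper intro!: least)
qed

end

section \<open>Irreducibility of the complement of the top\<close>

lemma Sup_range_Chain: "Sup (range (Chain p)) = Peak p"
  by (intro antisym Sup_least Chain_unbounded_le) (auto intro: near_self Sup_upper)

text \<open>If the chain met \<open>F\<close> at arbitrarily large heights, all of it would lie in
  \<open>F\<close>, and so would its supremum \<open>Peak p\<close>.\<close>

lemma scott_closed_Peak:
  assumes "scott_closed F" "Peak p \<notin> F"
  shows "\<exists>m. \<forall>n\<ge>m. Chain p n \<notin> F"
proof (rule ccontr)
  assume "\<not> ?thesis"
  then have "range (Chain p) \<subseteq> F"
    using scott_closed_down[OF assms(1)] by (meson image_subsetI less_eq_lat.simps)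
  moreover have "updirected (range (Chain p))"
    unfolding updirected_def by simp (meson max.cobounded1 max.cobounded2)
  ultimately show False
    using scott_closed_Sup[OF assms(1)] assms(2) Sup_range_Chain by metis
qed

text \<open>A directed set without \<open>Top\<close> has a peak as greatest element, or lies in one
  chain together with \<open>Bot\<close>, or is \<open>{Bot}\<close>; a peak bounds it in each
  case.\<close>

lemma scott_closed_not_Top: "scott_closed (- {Top})"
  unfolding scott_closed_def
proof (intro conjI ballI allI impI)
  fix x y :: lat assume "x \<in> - {Top}" "y \<le> x"
  then show "y \<in> - {Top}" by (auto simp: Top_le_iff)
next
  fix D :: "lat set" assume D: "updirected D" "D \<subseteq> - {Top}"
  have "\<exists>p. \<forall>x\<in>D. x \<le> Peak p"
  proof (cases "\<exists>p. Peak p \<in> D")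
    case True
    then obtain p where p: "Peak p \<in> D" by blast
    have "x \<le> Peak p" if x: "x \<in> D" for x
    proof -
      obtain z where z: "z \<in> D" "x \<le> z" "Peak p \<le> z" using updirectedE[OF D(1) x p] .
      then have "z = Peak p" using D(2) by (auto simp: Peak_le_iff)
      then show ?thesis using z(2) by simp
    qed
    then show ?thesis by blast
  next
    case noPeak: False
    show ?thesis
    proof (cases "\<exists>p m. Chain p m \<in> D")
      case True
      then obtain p m where p: "Chain p m \<in> D" by blast
      have "x \<le> Peak p" if x: "x \<in> D" for x
      proof -
        obtain z where z: "z \<in> D" "x \<le> z" "Chain p m \<le> z" using updirectedE[OF D(1) x p] .
        then obtain n where "z = Chain p n" using D(2) noPeak by (auto simp: Chain_le_iff)
        then have "z \<le> Peak p" by (simp add: near_self)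
        with z(2) show ?thesis by (rule order_trans)
      qed
      then show ?thesis by blast
    next
      case False
      then have "x = Bot" if "x \<in> D" for x using that D(2) noPeak by (cases x) auto
      then have "x \<le> Peak Root" if "x \<in> D" for x
        using that by (metis less_eq_lat.simps(1))
      then show ?thesis by blast
    qed
  qed
  then obtain p where "Sup D \<le> Peak p" using Sup_least by blast
  then show "Sup D \<in> - {Top}" by auto
qed

text \<open>The complements of \<open>F1\<close> and \<open>F2\<close> contain peaks of some
  \<open>p\<close> and \<open>q\<close>, hence tails of their chains, hence the peaks of all
  \<open>Lnode\<close> and \<open>Rnode\<close> neighbours at a large height \<open>k\<close>, hence
  tails of those chains, from \<open>f i\<close> and \<open>g h\<close> on. A \<open>Link\<close>
  attached at a height beyond both bounds has its peak outside
  \<open>F1 \<union> F2\<close>.\<close>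

lemma not_Top_irreducible:
  assumes F: "scott_closed F1" "scott_closed F2" and cover: "- {Top} \<subseteq> F1 \<union> F2"
  shows "- {Top} \<subseteq> F1 \<or> - {Top} \<subseteq> F2"
proof (rule ccontr)
  assume "\<not> ?thesis"
  then obtain u v where "u \<noteq> Top" "u \<notin> F1" "v \<noteq> Top" "v \<notin> F2" by blast
  moreover from this obtain p q where "u \<le> Peak p" "v \<le> Peak q" by (metis below_Peak)
  ultimately have "Peak p \<notin> F1" "Peak q \<notin> F2"
    using scott_closed_down[OF F(1)] scott_closed_down[OF F(2)] by blast+
  then obtain k1 k2 where "\<forall>n\<ge>k1. Chain p n \<notin> F1" "\<forall>n\<ge>k2. Chain q n \<notin> F2"
    using scott_closed_Peak F by metis
  then obtain k where k: "Chain p k \<notin> F1" "Chain q k \<notin> F2"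
    by (meson max.cobounded1 max.cobounded2)
  have "Peak (Lnode p q k i) \<notin> F1" for i
    using scott_closed_down[OF F(1), of "Peak (Lnode p q k i)" "Chain p k"] k(1) near_Lnode[of k k p q i]
    by auto
  then have "\<forall>i. \<exists>m. \<forall>n\<ge>m. Chain (Lnode p q k i) n \<notin> F1" using scott_closed_Peak F(1) by blast
  then obtain f where f: "\<And>i n. f i \<le> n \<Longrightarrow> Chain (Lnode p q k i) n \<notin> F1" by metis
  have "Peak (Rnode p q k h) \<notin> F2" for h
    using scott_closed_down[OF F(2), of "Peak (Rnode p q k h)" "Chain q k"] k(2) near_Rnode[of k k q p h]
    by auto
  then have "\<forall>h. \<exists>m. \<forall>n\<ge>m. Chain (Rnode p q k h) n \<notin> F2" using scott_closed_Peak F(2) by blast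
  then obtain g where g: "\<And>h n. g h \<le> n \<Longrightarrow> Chain (Rnode p q k h) n \<notin> F2" by metis
  \<comment> \<open>\<open>h\<close> has to be chosen before \<open>i\<close>, without knowing \<open>g h\<close>; being unbounded it still exceeds \<open>g h\<close>.\<close>
  define h where "h i = max (f i) i" for i
  define i where "i = g h"
  let ?r = "Peak (Link p q k i h)"
  have "Chain (Lnode p q k i) (h i) \<notin> F1" "Chain (Rnode p q k h) (h i) \<notin> F2"
    using f[of i] g[of h] by (simp_all add: h_def i_def)
  moreover have "Chain (Lnode p q k i) (h i) \<le> ?r" "Chain (Rnode p q k h) (h i) \<le> ?r"
    by (auto intro: near_Link_Lnode near_Link_Rnode)
  ultimately have "?r \<notin> F1 \<union> F2" using scott_closed_down F by blast
  then show False using cover by blast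
qed

lemma not_Top_no_greatest:
  assumes "e \<noteq> Top"
  shows "\<exists>x\<in>- {Top}. \<not> x \<le> e"
proof -
  \<comment> \<open>Only \<open>Top\<close> lies above two distinct peaks.\<close>
  have "\<not> (Peak Root \<le> e \<and> Peak (Lnode Root Root 0 0) \<le> e)"
    using assms by (auto simp: Peak_le_iff)
  then show ?thesis by blast
qed

section \<open>Encoding into the carrier universe\<close>

text \<open>An injective pairing of sets of naturals through their disjoint sum.\<close>

definition join :: "nat set \<Rightarrow> nat set \<Rightarrow> nat set" where
  "join S T = sum_encode ` (S <+> T)"

lemma join_eq_iff [simp]: "join S T = join S' T' \<longleftrightarrow> S = S' \<and> T = T'"
proof
  assume "join S T = join S' T'"
  then have eq: "S <+> T = S' <+> T'"
    unfolding join_def by (simp only: inj_image_eq_iff[OF inj_sum_encode])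
  have "Inl -` (A <+> B) = A" "Inr -` (A <+> B) = B" for A B :: "nat set" by auto
  then show "S = S' \<and> T = T'" using eq by metis
qed simp

definition graph :: "(nat \<Rightarrow> nat) \<Rightarrow> nat set" where
  "graph h = range (\<lambda>i. prod_encode (i, h i))"

lemma graph_eq_iff [simp]: "graph h = graph h' \<longleftrightarrow> h = h'"
proof
  assume eq: "graph h = graph h'"
  show "h = h'"
  proof
    fix i
    have "prod_encode (i, h i) \<in> graph h" by (simp add: graph_def)
    then have "prod_encode (i, h i) \<in> graph h'" by (simp only: eq)
    then show "h i = h' i" by (auto simp: graph_def)
  qed
qed simp

text \<open>Uncountably many functions \<open>h\<close> occur, so codes are sets of naturals rather
  than naturals. The leading tag separates the constructors.\<close>

primrec code_point :: "point \<Rightarrow> nat set" where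
  "code_point Root = join {0} {}"
| "code_point (Lnode p q k i) = join {1} (join (join (code_point p) (code_point q)) (join {k} {i}))"
| "code_point (Rnode p q k h) = join {2} (join (join (code_point p) (code_point q)) (join {k} (graph h)))"
| "code_point (Link p q k i h) =
     join {3} (join (join (code_point p) (code_point q)) (join {k} (join {i} (graph h))))"

lemma code_point_eq_iff: "code_point p = code_point q \<longleftrightarrow> p = q"
proof (induction p arbitrary: q)
  case Root then show ?case by (cases q) auto
next
  case Lnode then show ?case by (cases q) auto
next
  case Rnode then show ?case by (cases q) auto
next
  case Link then show ?case by (cases q) auto
qed

fun code_lat :: "lat \<Rightarrow> nat set" where
  "code_lat Bot = join {0} {}"
| "code_lat (Chain p m) = join {1} (join (code_point p) {m})"
| "code_lat (Peak p) = join {2} (code_point p)"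
| "code_lat Top = join {3} {}"

lemma inj_code_lat: "inj code_lat"
proof (rule injI)
  fix u v assume "code_lat u = code_lat v"
  then show "u = v" by (cases u; cases v) (auto simp: code_point_eq_iff)
qed

theorem mainTheorem3:
  shows "\<exists>A :: carrier_universe gorder.
    complete_heyting_algebra A \<and> \<not> sober_space (scott_topology A)"
proof -
  \<comment> \<open>\<open>code_lat\<close> turns a compact upper set into a
    \<open>nat set set\<close>; the outer singleton lifts it injectively to the carrier
    universe.\<close>
  let ?\<phi> = "\<lambda>K. {code_lat ` K}"
  have inj: "inj ?\<phi>" by (rule injI) (simp add: inj_image_eq_iff[OF inj_code_lat])
  have "\<not> sober_space (scott_topology (smyth ?\<phi>))"
    by (rule smyth_not_sober[OF inj scott_closed_not_Top _ not_Top_irreducible])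
      (use not_Top_no_greatest in auto)
  with complete_heyting_algebra_smyth[OF inj] show ?thesis by blast
qed

end
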